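(* Let $\|\cdot\|$ be any matrix norm. Consider the following program in the decision variables $P_1\in\mathbb S^{n\times n}$, $Y_1\in\mathbb R^{T\times n}$, $G_2\in\mathbb R^{T\times(S-n)}$: minimize $\|X_1G_2\|$ subject to $$Z_0Y_1=\begin{bmatrix}P_1\\ 0_{(S-n)\times n}\end{bmatrix},\qquad \begin{bmatrix}P_1&(X_1Y_1)^\top\\ X_1Y_1&P_1\end{bmatrix}\succ0,\qquad Z_0G_2=\begin{bmatrix}0_{n\times(S-n)}\\ I_{S-n}\end{bmatrix}.$$ If the program is feasible and a solution $(P_1,Y_1,G_2)$ achieves zero cost (i.e. $\|X_1G_2\|=0$), then the control law $u=KZ(x)$ with $$K=U_0\begin{bmatrix}Y_1&G_2\end{bmatrix}\begin{bmatrix}P_1&0_{n\times(S-n)}\\ 0_{(S-n)\times n}&I_{S-n}\end{bmatrix}^{-1}$$ linearizes the closed-loop dynamics (i.e. there is $M\in\mathbb R^{n\times n}$ with $AZ(x)+BKZ(x)=Mx$ for all $x\in\mathbb R^n$) and renders the origin a globally asymptotically stable equilibrium of the closed-loop system.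
   Context: Let $n,m,S,T$ be positive integers with $S\ge n$ (blocks of zero size are absent when $S=n$). Consider the discrete-time system $x^+=AZ(x)+Bu$, i.e. $x(t+1)=AZ(x(t))+Bu(t)$, with $x\in\mathbb R^n$, $u\in\mathbb R^m$, constant matrices $A\in\mathbb R^{n\times S}$, $B\in\mathbb R^{n\times m}$ (unknown to the designer), and $Z(x)=\begin{bmatrix}x\\ Q(x)\end{bmatrix}$ with a known function $Q:\mathbb R^n\to\mathbb R^{S-n}$. Data: samples $x(0),\dots,x(T)\in\mathbb R^n$, $u(0),\dots,u(T-1)\in\mathbb R^m$ satisfying $x(k+1)=AZ(x(k))+Bu(k)$ for $k=0,\dots,T-1$. Define $U_0=[u(0)\ \cdots\ u(T-1)]\in\mathbb R^{m\times T}$, $X_1=[x(1)\ \cdots\ x(T)]\in\mathbb R^{n\times T}$, $Z_0=[Z(x(0))\ \cdots\ Z(x(T-1))]\in\mathbb R^{S\times T}$. $\mathbb S^{n\times n}$ is the set of real symmetric $n\times n$ matrices; $\succ0$ means positive definite. *)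

theory Defs
  imports Complex_Main "Jordan_Normal_Form.Gauss_Jordan_Elimination"
begin

(* Matrices are those of Jordan_Normal_Form, whose dimensions are terms and may be 0;
   with type-indexed dimensions the case of an empty block, S = n, could not be stated. *)

definition append_cols :: "real mat \<Rightarrow> real mat \<Rightarrow> real mat" (infixr \<open>@\<^sub>c\<close> 65) where
  "A @\<^sub>c B = four_block_mat A B (0\<^sub>m 0 (dim_col A)) (0\<^sub>m 0 (dim_col B))"

definition symmetric_mats :: "nat \<Rightarrow> real mat set" where
  "symmetric_mats n = {P \<in> carrier_mat n n. P\<^sup>T = P}"

definition positive_definite :: "nat \<Rightarrow> real mat \<Rightarrow> bool" where
  "positive_definite n P \<longleftrightarrow> P \<in> symmetric_mats n \<and>
     (\<forall>v \<in> carrier_vec n. v \<noteq> 0\<^sub>v n \<longrightarrow> v \<bullet> (P *\<^sub>v v) > 0)"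

(* Submultiplicativity is not required: the cost is the norm of a rectangular matrix, and
   a claim for every norm of this kind covers the submultiplicative ones. *)
definition matrix_norm :: "nat \<Rightarrow> nat \<Rightarrow> (real mat \<Rightarrow> real) \<Rightarrow> bool" where
  "matrix_norm r c N \<longleftrightarrow>
     (\<forall>M \<in> carrier_mat r c. N M \<ge> 0 \<and> (N M = 0 \<longleftrightarrow> M = 0\<^sub>m r c)) \<and>
     (\<forall>a. \<forall>M \<in> carrier_mat r c. N (a \<cdot>\<^sub>m M) = \<bar>a\<bar> * N M) \<and>
     (\<forall>M \<in> carrier_mat r c. \<forall>M' \<in> carrier_mat r c. N (M + M') \<le> N M + N M')"

definition feasible ::
  "nat \<Rightarrow> nat \<Rightarrow> nat \<Rightarrow> real mat \<Rightarrow> real mat \<Rightarrow> real mat \<Rightarrow> real mat \<Rightarrow> real mat \<Rightarrow> bool" where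
  "feasible n S T X1 Z0 P1 Y1 G2 \<longleftrightarrow>
     P1 \<in> symmetric_mats n \<and> Y1 \<in> carrier_mat T n \<and> G2 \<in> carrier_mat T (S - n) \<and>
     Z0 * Y1 = P1 @\<^sub>r 0\<^sub>m (S - n) n \<and>
     positive_definite (n + n) (four_block_mat P1 ((X1 * Y1)\<^sup>T) (X1 * Y1) P1) \<and>
     Z0 * G2 = 0\<^sub>m n (S - n) @\<^sub>r 1\<^sub>m (S - n)"

definition optimal_solution ::
  "(real mat \<Rightarrow> real) \<Rightarrow> nat \<Rightarrow> nat \<Rightarrow> nat \<Rightarrow> real mat \<Rightarrow> real mat \<Rightarrow>
   real mat \<Rightarrow> real mat \<Rightarrow> real mat \<Rightarrow> bool" where
  "optimal_solution N n S T X1 Z0 P1 Y1 G2 \<longleftrightarrow>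
     feasible n S T X1 Z0 P1 Y1 G2 \<and>
     (\<forall>P1' Y1' G2'. feasible n S T X1 Z0 P1' Y1' G2' \<longrightarrow> N (X1 * G2) \<le> N (X1 * G2'))"

definition eucl_norm :: "real vec \<Rightarrow> real" where
  "eucl_norm v = sqrt (v \<bullet> v)"

(* The origin as an equilibrium of x(t+1) = f (x(t)) on R^n: Lyapunov stable and
   globally attractive. *)
definition globally_asymptotically_stable :: "nat \<Rightarrow> (real vec \<Rightarrow> real vec) \<Rightarrow> bool" where
  "globally_asymptotically_stable n f \<longleftrightarrow>
     f (0\<^sub>v n) = 0\<^sub>v n \<and>
     (\<forall>\<epsilon>>0. \<exists>\<delta>>0. \<forall>\<xi> \<in> carrier_vec n. eucl_norm \<xi> < \<delta> \<longrightarrow>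
        (\<forall>t. eucl_norm ((f ^^ t) \<xi>) < \<epsilon>)) \<and>
     (\<forall>\<xi> \<in> carrier_vec n. (\<lambda>t. eucl_norm ((f ^^ t) \<xi>)) \<longlonglongrightarrow> 0)"

end

theory Submission
  imports Defs "Jordan_Normal_Form.Determinant"
begin

text \<open>Since \<open>X\<^sub>1 = A Z\<^sub>0 + B U\<^sub>0\<close> and \<open>Z\<^sub>0 [Y\<^sub>1 G\<^sub>2] = diag(P\<^sub>1, I)\<close>, the closed-loop matrix is
  \<open>A + B K = X\<^sub>1 [Y\<^sub>1 G\<^sub>2] diag(P\<^sub>1, I)\<inverse>\<close>, which is \<open>[M 0]\<close> with \<open>M = X\<^sub>1 Y\<^sub>1 P\<^sub>1\<inverse>\<close> because the zero
  cost forces \<open>X\<^sub>1 G\<^sub>2 = 0\<close>. The matrix inequality makes \<open>V(\<xi>) = \<xi> \<bullet> P\<^sub>1\<inverse> \<xi>\<close> a strict Lyapunov function: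
  evaluated at \<open>(P\<^sub>1\<inverse> \<xi>, - P\<^sub>1\<inverse> M \<xi>)\<close> its quadratic form equals \<open>V(\<xi>) - V(M \<xi>)\<close>.\<close>

section \<open>Bounds for quadratic forms and invertibility of definite matrices\<close>

lemma scalar_prod_self_nonneg: "0 \<le> (v :: real vec) \<bullet> v"
  unfolding scalar_prod_def by (intro sum_nonneg) auto

lemma index_square_le_scalar_prod_self:
  fixes v :: "real vec"
  assumes "i < dim_vec v"
  shows "(v $ i)\<^sup>2 \<le> v \<bullet> v"
proof -
  have "v $ i * v $ i \<le> (\<Sum>k = 0..<dim_vec v. v $ k * v $ k)"
    using assms by (intro member_le_sum) auto
  then show ?thesis by (simp add: scalar_prod_def power2_eq_square)
qed

text \<open>Bounding entry by entry suffices: the inequality between arithmetic and geometric means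
  gives 2 |v_i v_j| \<le> v_i^2 + v_j^2, and both squares are at most \<open>v \<bullet> v\<close>.
  The extra 1 in the constant keeps it positive even for the zero matrix.\<close>

lemma quadratic_form_upper_bound:
  assumes R: "R \<in> carrier_mat n n"
  obtains C :: real where "0 < C" "\<And>v. v \<in> carrier_vec n \<Longrightarrow> v \<bullet> (R *\<^sub>v v) \<le> C * (v \<bullet> v)"
proof
  let ?C = "1 + (\<Sum>i = 0..<n. \<Sum>j = 0..<n. \<bar>R $$ (i, j)\<bar>)"
  show "0 < ?C" by (intro add_pos_nonneg sum_nonneg) auto
  fix v :: "real vec" assume v: "v \<in> carrier_vec n"
  have entry: "v $ i * (R $$ (i, j) * v $ j) \<le> \<bar>R $$ (i, j)\<bar> * (v \<bullet> v)" if "i < n" "j < n" for i j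
  proof -
    have "(v $ i)\<^sup>2 \<le> v \<bullet> v" "(v $ j)\<^sup>2 \<le> v \<bullet> v"
      using that v by (auto intro: index_square_le_scalar_prod_self)
    moreover have "0 \<le> (\<bar>v $ i\<bar> - \<bar>v $ j\<bar>)\<^sup>2" by simp
    ultimately have "\<bar>v $ i * v $ j\<bar> \<le> v \<bullet> v"
      by (simp add: power2_diff abs_mult)
    then have "\<bar>R $$ (i, j)\<bar> * \<bar>v $ i * v $ j\<bar> \<le> \<bar>R $$ (i, j)\<bar> * (v \<bullet> v)"
      by (rule mult_left_mono) simp
    moreover have "v $ i * (R $$ (i, j) * v $ j) \<le> \<bar>R $$ (i, j)\<bar> * \<bar>v $ i * v $ j\<bar>"
      by (metis abs_ge_self abs_mult mult.left_commute)
    ultimately show ?thesis by linarith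
  qed
  have "v \<bullet> (R *\<^sub>v v) = (\<Sum>i = 0..<n. \<Sum>j = 0..<n. v $ i * (R $$ (i, j) * v $ j))"
    using R v by (simp add: scalar_prod_def sum_distrib_left)
  also have "\<dots> \<le> (\<Sum>i = 0..<n. \<Sum>j = 0..<n. \<bar>R $$ (i, j)\<bar> * (v \<bullet> v))"
    by (intro sum_mono entry) auto
  also have "\<dots> \<le> ?C * (v \<bullet> v)"
    using scalar_prod_self_nonneg[of v] by (simp add: sum_distrib_right distrib_right)
  finally show "v \<bullet> (R *\<^sub>v v) \<le> ?C * (v \<bullet> v)" .
qed

lemma symmetric_mats_scalar_prod:
  assumes "P \<in> symmetric_mats n" "v \<in> carrier_vec n" "w \<in> carrier_vec n"
  shows "v \<bullet> (P *\<^sub>v w) = (P *\<^sub>v v) \<bullet> w"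
  using transpose_vec_mult_scalar[of P n n w v] assms by (auto simp: symmetric_mats_def)

lemma positive_definite_det_nonzero:
  assumes "positive_definite n P"
  shows "det P \<noteq> 0"
proof
  assume "det P = 0"
  moreover have "P \<in> carrier_mat n n"
    using assms by (auto simp: positive_definite_def symmetric_mats_def)
  ultimately obtain v where "v \<in> carrier_vec n" "v \<noteq> 0\<^sub>v n" "P *\<^sub>v v = 0\<^sub>v n"
    using det_0_iff_vec_prod_zero by blast
  then show False
    using assms by (fastforce simp: positive_definite_def)
qed

text \<open>Links the computed inverse to the determinant. The gain \<open>K\<close> is written with
  \<open>the (mat_inverse ...)\<close>, which says something only once the result is known to be
  \<open>Some\<close>.\<close>

lemma mat_inverse_det_nonzero:
  fixes P :: "'a :: field mat"
  assumes P: "P \<in> carrier_mat n n" and det: "det P \<noteq> 0"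
  obtains R where "mat_inverse P = Some R" "R \<in> carrier_mat n n" "P * R = 1\<^sub>m n" "R * P = 1\<^sub>m n"
proof (cases "mat_inverse P")
  case None
  then show ?thesis
    using mat_inverse(1)[OF P, of "()"] det_non_zero_imp_unit[OF P det, of "()"] by blast
next
  case (Some R)
  then show ?thesis
    using mat_inverse(2)[OF P] that by blast
qed

text \<open>Expanding \<open>0 \<le> (v - s R\<inverse> v) \<bullet> R (v - s R\<inverse> v)\<close> and choosing \<open>s\<close> as the inverse of an upper bound
  of \<open>R\<inverse>\<close> avoids a compactness argument on the unit sphere.\<close>

lemma positive_definite_lower_bound:
  assumes pd: "positive_definite n R"
  obtains c :: real where "0 < c" "\<And>v. v \<in> carrier_vec n \<Longrightarrow> c * (v \<bullet> v) \<le> v \<bullet> (R *\<^sub>v v)"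
proof -
  have sym: "R \<in> symmetric_mats n" and R: "R \<in> carrier_mat n n"
    using pd by (auto simp: positive_definite_def symmetric_mats_def)
  obtain G where G: "G \<in> carrier_mat n n" "R * G = 1\<^sub>m n"
    using mat_inverse_det_nonzero[OF R positive_definite_det_nonzero[OF pd]] by metis
  obtain C where C: "0 < C" "\<And>v. v \<in> carrier_vec n \<Longrightarrow> v \<bullet> (G *\<^sub>v v) \<le> C * (v \<bullet> v)"
    using quadratic_form_upper_bound[OF G(1)] by blast
  show ?thesis
  proof (rule that)
    show "0 < 1 / C" using C by simp
    fix v :: "real vec" assume v: "v \<in> carrier_vec n"
    define y where "y = G *\<^sub>v v"
    have y: "y \<in> carrier_vec n" using G v by (simp add: y_def)
    have Ry: "R *\<^sub>v y = v"
      using assoc_mult_mat_vec[OF R G(1) v] G v by (simp add: y_def)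
    let ?s = "1 / C"
    let ?w = "v - ?s \<cdot>\<^sub>v y"
    have w: "?w \<in> carrier_vec n" using v y by simp
    have vRv: "R *\<^sub>v v \<in> carrier_vec n" using R v by simp
    have Rw: "R *\<^sub>v ?w = R *\<^sub>v v - ?s \<cdot>\<^sub>v v"
      using R v y by (simp add: mult_minus_distrib_mat_vec[of _ n n] mult_mat_vec[of _ n n] Ry)
    have cross: "y \<bullet> (R *\<^sub>v v) = v \<bullet> v"
      using symmetric_mats_scalar_prod[OF sym y v] by (simp add: Ry)
    have "0 \<le> ?w \<bullet> (R *\<^sub>v ?w)"
    proof (cases "?w = 0\<^sub>v n")
      case True
      then show ?thesis using R by (metis mult_mat_vec_carrier order_refl scalar_prod_left_zero zero_carrier_vec)
    next
      case False
      then show ?thesis using pd w by (auto simp: positive_definite_def less_imp_le)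
    qed
    also have "\<dots> = v \<bullet> (R *\<^sub>v v) - 2 * ?s * (v \<bullet> v) + ?s\<^sup>2 * (v \<bullet> y)"
      unfolding Rw using v y vRv cross comm_scalar_prod[OF y v]
      by (simp add: minus_scalar_prod_distrib[of _ n] scalar_prod_minus_distrib[of _ n]
          power2_eq_square algebra_simps)
    \<comment> \<open>Because \<open>C * ?s = 1\<close>, the last term becomes
      \<open>?s * (v \<bullet> v)\<close> and cancels one of the two copies subtracted before
      it.\<close>
    also have "\<dots> \<le> v \<bullet> (R *\<^sub>v v) - 2 * ?s * (v \<bullet> v) + ?s\<^sup>2 * (C * (v \<bullet> v))"
      using C(2)[OF v] by (simp add: y_def mult_left_mono)
    also have "\<dots> = v \<bullet> (R *\<^sub>v v) - ?s * (v \<bullet> v)"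
      using C(1) by (simp add: power2_eq_square field_simps)
    finally show "?s * (v \<bullet> v) \<le> v \<bullet> (R *\<^sub>v v)" by simp
  qed
qed

section \<open>Block matrices and the data equation\<close>

lemma append_cols_carrier:
  assumes "X \<in> carrier_mat r c1" "Y \<in> carrier_mat r c2"
  shows "X @\<^sub>c Y \<in> carrier_mat r (c1 + c2)"
  using assms unfolding append_cols_def by auto

lemma col_append_cols:
  assumes "X \<in> carrier_mat r c1" "Y \<in> carrier_mat r c2" "j < c1 + c2"
  shows "col (X @\<^sub>c Y) j = (if j < c1 then col X j else col Y (j - c1))"
  using assms unfolding append_cols_def by (intro eq_vecI) auto

lemma mult_append_cols:
  assumes L: "L \<in> carrier_mat p r" and X: "X \<in> carrier_mat r c1" and Y: "Y \<in> carrier_mat r c2"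
  shows "L * (X @\<^sub>c Y) = (L * X) @\<^sub>c (L * Y)"
proof (rule mat_col_eqI)
  note XY = append_cols_carrier[OF X Y]
  have LX: "L * X \<in> carrier_mat p c1" and LY: "L * Y \<in> carrier_mat p c2" using L X Y by auto
  show "dim_row (L * (X @\<^sub>c Y)) = dim_row (L * X @\<^sub>c L * Y)"
    and "dim_col (L * (X @\<^sub>c Y)) = dim_col (L * X @\<^sub>c L * Y)"
    using L XY append_cols_carrier[OF LX LY] by auto
  fix j assume "j < dim_col (L * X @\<^sub>c L * Y)"
  then have j: "j < c1 + c2" using append_cols_carrier[OF LX LY] by auto
  show "col (L * (X @\<^sub>c Y)) j = col (L * X @\<^sub>c L * Y) j"
    using j by (simp add: col_mult2[OF L XY j] col_append_cols[OF X Y j] col_append_cols[OF LX LY j]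
        col_mult2[OF L X] col_mult2[OF L Y])
qed

lemma append_cols_append_rows:
  assumes "X1 \<in> carrier_mat r1 c1" "X2 \<in> carrier_mat r2 c1"
    and "Y1 \<in> carrier_mat r1 c2" "Y2 \<in> carrier_mat r2 c2"
  shows "(X1 @\<^sub>r X2) @\<^sub>c (Y1 @\<^sub>r Y2) = four_block_mat X1 Y1 X2 Y2"
  using assms unfolding append_cols_def append_rows_def by (intro eq_matI) auto

text \<open>Applied with \<open>w\<close> the value of \<open>Q\<close>, this is where the
  nonlinearity drops out of the closed loop.\<close>

lemma append_cols_zero_mult_vec:
  assumes "M \<in> carrier_mat r c1" "v \<in> carrier_vec c1" "w \<in> carrier_vec c2"
  shows "(M @\<^sub>c 0\<^sub>m r c2) *\<^sub>v (v @\<^sub>v w) = (M :: real mat) *\<^sub>v v"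
proof (rule eq_vecI)
  fix i assume "i < dim_vec (M *\<^sub>v v)"
  then have i: "i < r" using assms by simp
  have "row (M @\<^sub>c 0\<^sub>m r c2) i = row M i @\<^sub>v 0\<^sub>v c2"
    using i assms unfolding append_cols_def by (intro eq_vecI) auto
  moreover have "dim_row (M @\<^sub>c 0\<^sub>m r c2) = r"
    using assms unfolding append_cols_def by simp
  ultimately show "((M @\<^sub>c 0\<^sub>m r c2) *\<^sub>v (v @\<^sub>v w)) $ i = (M *\<^sub>v v) $ i"
    using i assms by (simp add: scalar_prod_append[of _ c1 _ c2])
qed (use assms in \<open>simp add: append_cols_def\<close>)

text \<open>Read from right to left, it factors the block diagonal matrix out of the data product,
  so that the inverse inside \<open>K\<close> can cancel it.\<close>

lemma append_cols_zero_mult_block_diag: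
  assumes M: "M \<in> carrier_mat r n" and P: "P \<in> carrier_mat n n"
  shows "(M @\<^sub>c 0\<^sub>m r k) * four_block_mat P (0\<^sub>m n k) (0\<^sub>m k n) (1\<^sub>m k) = (M * P) @\<^sub>c 0\<^sub>m r k"
proof -
  have [simp]: "dim_col M = n" using M by simp
  have "(M @\<^sub>c 0\<^sub>m r k) * four_block_mat P (0\<^sub>m n k) (0\<^sub>m k n) (1\<^sub>m k) =
      four_block_mat (M * P + 0\<^sub>m r k * 0\<^sub>m k n) (M * 0\<^sub>m n k + 0\<^sub>m r k * 1\<^sub>m k)
        (0\<^sub>m 0 n * P + 0\<^sub>m 0 k * 0\<^sub>m k n) (0\<^sub>m 0 n * 0\<^sub>m n k + 0\<^sub>m 0 k * 1\<^sub>m k)"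
    using mult_four_block_mat[OF M zero_carrier_mat zero_carrier_mat zero_carrier_mat P
        zero_carrier_mat zero_carrier_mat one_carrier_mat, of k 0]
    by (simp add: append_cols_def)
  then show ?thesis using M P unfolding append_cols_def by simp
qed

text \<open>Column \<open>j\<close> of the left-hand side is the successor state
  \<open>x (j + 1)\<close>, so the equation collects the sampled dynamics column by column. Through
  it the unknown \<open>A\<close> and \<open>B\<close> are traded for data.\<close>

lemma data_matrix_identity:
  fixes A B :: "real mat"
  assumes A: "A \<in> carrier_mat n S" and B: "B \<in> carrier_mat n m"
    and z: "\<forall>k<T. z k \<in> carrier_vec S" and u: "\<forall>k<T. u k \<in> carrier_vec m"
    and dyn: "\<forall>k<T. x (k + 1) = A *\<^sub>v z k + B *\<^sub>v u k"
  shows "mat_of_cols n (map (\<lambda>k. x (k + 1)) [0..<T]) =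
    A * mat_of_cols S (map z [0..<T]) + B * mat_of_cols m (map u [0..<T])"
proof (rule mat_col_eqI)
  let ?Z = "mat_of_cols S (map z [0..<T])" and ?U = "mat_of_cols m (map u [0..<T])"
  have Z: "?Z \<in> carrier_mat S T" and U: "?U \<in> carrier_mat m T"
    using mat_of_cols_carrier(1)[of S "map z [0..<T]"] mat_of_cols_carrier(1)[of m "map u [0..<T]"]
    by simp_all
  fix j assume "j < dim_col (A * ?Z + B * ?U)"
  then have j: "j < T" by simp
  have xj: "x (j + 1) \<in> carrier_vec n" using dyn j A B z u by auto
  have "col (A * ?Z + B * ?U) j = col (A * ?Z) j + col (B * ?U) j"
    using j A B by (intro col_add) auto
  also have "\<dots> = A *\<^sub>v z j + B *\<^sub>v u j"
    using j z u by (simp add: col_mult2[OF A Z j] col_mult2[OF B U j])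
  finally show "col (mat_of_cols n (map (\<lambda>k. x (k + 1)) [0..<T])) j = col (A * ?Z + B * ?U) j"
    using dyn j xj by simp
qed (use A B in auto)

section \<open>Lyapunov functions and the matrix inequality\<close>

text \<open>Iterating the contraction of \<open>V\<close> and sandwiching \<open>V\<close> between
  multiples of the squared norm gives one exponential estimate, \<open>bound\<close>, from which
  both stability and attractivity follow.\<close>

lemma globally_asymptotically_stable_of_lyapunov:
  assumes f: "\<And>\<xi>. \<xi> \<in> carrier_vec n \<Longrightarrow> f \<xi> \<in> carrier_vec n"
    and b: "0 < b" and c: "0 < c" and \<rho>: "0 \<le> \<rho>" "\<rho> < 1"
    and lower: "\<And>\<xi>. \<xi> \<in> carrier_vec n \<Longrightarrow> b * (\<xi> \<bullet> \<xi>) \<le> V \<xi>"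
    and upper: "\<And>\<xi>. \<xi> \<in> carrier_vec n \<Longrightarrow> V \<xi> \<le> c * (\<xi> \<bullet> \<xi>)"
    and decrease: "\<And>\<xi>. \<xi> \<in> carrier_vec n \<Longrightarrow> V (f \<xi>) \<le> \<rho> * V \<xi>"
  shows "globally_asymptotically_stable n f"
proof -
  have iter: "(f ^^ t) \<xi> \<in> carrier_vec n \<and> V ((f ^^ t) \<xi>) \<le> \<rho> ^ t * V \<xi>"
    if \<xi>: "\<xi> \<in> carrier_vec n" for \<xi> t
  proof (induction t)
    case (Suc t)
    then have "V ((f ^^ Suc t) \<xi>) \<le> \<rho> * V ((f ^^ t) \<xi>)" using decrease by simp
    also have "\<dots> \<le> \<rho> * (\<rho> ^ t * V \<xi>)" using Suc \<rho> by (intro mult_left_mono) auto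
    finally show ?case using Suc f by (simp add: mult.assoc)
  qed (use \<xi> in simp)
  have bound: "eucl_norm ((f ^^ t) \<xi>) \<le> sqrt (\<rho> ^ t) * (sqrt (c / b) * eucl_norm \<xi>)"
    if \<xi>: "\<xi> \<in> carrier_vec n" for \<xi> t
  proof -
    let ?y = "(f ^^ t) \<xi>"
    have "b * (?y \<bullet> ?y) \<le> \<rho> ^ t * V \<xi>" using iter[OF \<xi>, of t] lower[of ?y] by linarith
    also have "\<dots> \<le> \<rho> ^ t * (c * (\<xi> \<bullet> \<xi>))" using \<rho> upper[OF \<xi>] by (intro mult_left_mono) auto
    finally have "?y \<bullet> ?y \<le> \<rho> ^ t * (c / b * (\<xi> \<bullet> \<xi>))" using b by (simp add: field_simps)
    then show ?thesis unfolding eucl_norm_def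
      by (metis real_sqrt_le_iff real_sqrt_mult)
  qed
  have norm_nonneg: "0 \<le> eucl_norm v" for v
    by (simp add: eucl_norm_def scalar_prod_self_nonneg)
  \<comment> \<open>The upper bound forces \<open>V\<close> to be at most 0 at the origin, the
    contraction carries this to the image of the origin, and the lower bound then makes that image
    vanish.\<close>
  have "f (0\<^sub>v n) = 0\<^sub>v n"
  proof -
    let ?y = "f (0\<^sub>v n)"
    have "V ?y \<le> \<rho> * V (0\<^sub>v n)" "V (0\<^sub>v n) \<le> 0"
      using decrease upper[of "0\<^sub>v n"] by auto
    then have "V ?y \<le> 0" using \<rho> by (meson mult_nonneg_nonpos order_trans)
    then have "b * (?y \<bullet> ?y) \<le> 0" using lower[OF f] by (meson order_trans zero_carrier_vec)
    then have "?y \<bullet> ?y \<le> 0" using b by (simp add: mult_le_0_iff)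
    then have "(?y $ i)\<^sup>2 \<le> 0" if "i < n" for i
      using that f[of "0\<^sub>v n"] by (intro order_trans[OF index_square_le_scalar_prod_self \<open>?y \<bullet> ?y \<le> 0\<close>]) auto
    then show ?thesis using f[of "0\<^sub>v n"] by (intro eq_vecI) auto
  qed
  moreover have "\<exists>\<delta>>0. \<forall>\<xi> \<in> carrier_vec n. eucl_norm \<xi> < \<delta> \<longrightarrow> (\<forall>t. eucl_norm ((f ^^ t) \<xi>) < \<epsilon>)"
    if "0 < \<epsilon>" for \<epsilon>
  proof (intro exI conjI ballI impI allI)
    \<comment> \<open>The divisor is the overshoot constant of \<open>bound\<close>, the factor
      \<open>sqrt (\<rho> ^ t)\<close> being at most 1.\<close>
    show "0 < \<epsilon> / sqrt (c / b)" using that b c by simp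
    fix \<xi> :: "real vec" and t assume \<xi>: "\<xi> \<in> carrier_vec n" and small: "eucl_norm \<xi> < \<epsilon> / sqrt (c / b)"
    have "sqrt (\<rho> ^ t) * (sqrt (c / b) * eucl_norm \<xi>) \<le> 1 * (sqrt (c / b) * eucl_norm \<xi>)"
      using \<rho> b c norm_nonneg by (intro mult_right_mono) (auto simp: power_le_one)
    also have "\<dots> < \<epsilon>"
      using small b c by (simp add: field_simps)
    finally show "eucl_norm ((f ^^ t) \<xi>) < \<epsilon>" using bound[OF \<xi>, of t] by linarith
  qed
  moreover have "(\<lambda>t. eucl_norm ((f ^^ t) \<xi>)) \<longlonglongrightarrow> 0" if \<xi>: "\<xi> \<in> carrier_vec n" for \<xi>
  proof (rule tendsto_sandwich[OF _ _ tendsto_const])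
    have "(\<lambda>t. sqrt (\<rho> ^ t)) \<longlonglongrightarrow> sqrt 0"
      using \<rho> by (intro tendsto_real_sqrt LIMSEQ_realpow_zero)
    then show "(\<lambda>t. sqrt (\<rho> ^ t) * (sqrt (c / b) * eucl_norm \<xi>)) \<longlonglongrightarrow> 0"
      by (simp add: tendsto_mult_left_zero)
  qed (use bound[OF \<xi>] norm_nonneg in auto)
  ultimately show ?thesis unfolding globally_asymptotically_stable_def by blast
qed

text \<open>Definiteness of the block matrix leaves a margin \<open>c\<close> uniform over all
  vectors. Comparing it with an upper bound \<open>C\<close> for the form of \<open>P\<close>
  improves the decrease of \<open>V\<close> to contraction by a fixed factor. The inverse
  \<open>R\<close> is handed out because the closed-loop matrix is built from it.\<close>

lemma lmi_stable:
  assumes P: "P \<in> symmetric_mats n" and F: "F \<in> carrier_mat n n"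
    and pd: "positive_definite (n + n) (four_block_mat P (F\<^sup>T) F P)"
  obtains R where "R \<in> carrier_mat n n" "P * R = 1\<^sub>m n" "R * P = 1\<^sub>m n"
    and "globally_asymptotically_stable n (\<lambda>\<xi>. (F * R) *\<^sub>v \<xi>)"
proof -
  let ?L = "four_block_mat P (F\<^sup>T) F P"
  have Pc: "P \<in> carrier_mat n n" using P by (simp add: symmetric_mats_def)
  have form: "(v @\<^sub>v w) \<bullet> (?L *\<^sub>v (v @\<^sub>v w)) = v \<bullet> (P *\<^sub>v v) + 2 * (w \<bullet> (F *\<^sub>v v)) + w \<bullet> (P *\<^sub>v w)"
    if v: "v \<in> carrier_vec n" and w: "w \<in> carrier_vec n" for v w
  proof -
    have "?L *\<^sub>v (v @\<^sub>v w) = (P *\<^sub>v v + F\<^sup>T *\<^sub>v w) @\<^sub>v (F *\<^sub>v v + P *\<^sub>v w)"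
      using Pc F v w by (intro four_block_mat_mult_vec) auto
    \<comment> \<open>The two off-diagonal blocks contribute equally, whence the factor 2 in
      \<open>form\<close>.\<close>
    moreover have "v \<bullet> (F\<^sup>T *\<^sub>v w) = w \<bullet> (F *\<^sub>v v)"
      using transpose_vec_mult_scalar[OF F v w] F v w
      by (metis comm_scalar_prod mult_mat_vec_carrier transpose_carrier_mat)
    ultimately show ?thesis using Pc F v w
      by (simp add: scalar_prod_append[of _ n _ n] scalar_prod_add_distrib[of _ n])
  qed
  obtain c where c: "0 < c"
    and low: "\<And>v. v \<in> carrier_vec (n + n) \<Longrightarrow> c * (v \<bullet> v) \<le> v \<bullet> (?L *\<^sub>v v)"
    using positive_definite_lower_bound[OF pd] by blast
  \<comment> \<open>Padding \<open>v\<close> with zeros isolates the upper left block, so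
    \<open>P\<close> inherits the margin \<open>c\<close>.\<close>
  have lowP: "c * (v \<bullet> v) \<le> v \<bullet> (P *\<^sub>v v)" if v: "v \<in> carrier_vec n" for v
    using low[of "v @\<^sub>v 0\<^sub>v n"] form[OF v zero_carrier_vec] v F Pc
    by (simp add: scalar_prod_append[of _ n _ n])
  have "positive_definite n P"
    unfolding positive_definite_def
  proof (intro conjI ballI impI P)
    fix v :: "real vec" assume v: "v \<in> carrier_vec n" "v \<noteq> 0\<^sub>v n"
    have "0\<^sub>v n @\<^sub>v 0\<^sub>v n = (0\<^sub>v (n + n) :: real vec)" by (intro eq_vecI) auto
    then have "v @\<^sub>v 0\<^sub>v n \<noteq> 0\<^sub>v (n + n)"
      using v append_vec_eq[OF v(1) zero_carrier_vec, of "0\<^sub>v n" "0\<^sub>v n"] by simp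
    then have "0 < (v @\<^sub>v 0\<^sub>v n) \<bullet> (?L *\<^sub>v (v @\<^sub>v 0\<^sub>v n))"
      using pd v unfolding positive_definite_def by simp
    then show "0 < v \<bullet> (P *\<^sub>v v)" using form[OF v(1) zero_carrier_vec] v F Pc by simp
  qed
  then obtain R where R: "R \<in> carrier_mat n n" "P * R = 1\<^sub>m n" "R * P = 1\<^sub>m n"
    using mat_inverse_det_nonzero[OF Pc positive_definite_det_nonzero] by metis
  have PR: "P *\<^sub>v (R *\<^sub>v \<xi>) = \<xi>" if "\<xi> \<in> carrier_vec n" for \<xi>
    using assoc_mult_mat_vec[OF Pc R(1) that] R that by simp
  have Rc: "R *\<^sub>v \<xi> \<in> carrier_vec n" if "\<xi> \<in> carrier_vec n" for \<xi>
    using R that by simp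
  define V where "V \<xi> = \<xi> \<bullet> (R *\<^sub>v \<xi>)" for \<xi>
  \<comment> \<open>Passing to \<open>R *\<^sub>v \<xi>\<close> makes every estimate for the form of
    \<open>P\<close> available for \<open>V\<close>, without deriving that \<open>R\<close> is
    symmetric.\<close>
  have V_eq: "V \<xi> = (R *\<^sub>v \<xi>) \<bullet> (P *\<^sub>v (R *\<^sub>v \<xi>))" if "\<xi> \<in> carrier_vec n" for \<xi>
    using PR[OF that] comm_scalar_prod[OF that Rc[OF that]] by (simp add: V_def)
  obtain C where C: "0 < C" "\<And>v. v \<in> carrier_vec n \<Longrightarrow> v \<bullet> (P *\<^sub>v v) \<le> C * (v \<bullet> v)"
    using quadratic_form_upper_bound[OF Pc] by blast
  obtain D where D: "0 < D" "\<And>v. v \<in> carrier_vec n \<Longrightarrow> v \<bullet> (R *\<^sub>v v) \<le> D * (v \<bullet> v)"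
    using quadratic_form_upper_bound[OF R(1)] by blast
  have PP: "P * P \<in> carrier_mat n n" using Pc by simp
  \<comment> \<open>For symmetric \<open>P\<close> this form is the squared norm of
    \<open>P *\<^sub>v v\<close>. Hence \<open>E\<close> bounds \<xi> by
    \<open>R *\<^sub>v \<xi>\<close>, which is what the lower bound on \<open>V\<close>
    requires.\<close>
  obtain E where E: "0 < E" "\<And>v. v \<in> carrier_vec n \<Longrightarrow> v \<bullet> ((P * P) *\<^sub>v v) \<le> E * (v \<bullet> v)"
    using quadratic_form_upper_bound[OF PP] by blast
  have "globally_asymptotically_stable n (\<lambda>\<xi>. (F * R) *\<^sub>v \<xi>)"
  \<comment> \<open>Truncating the contraction factor at 0 supplies its nonnegativity without
    comparing \<open>c\<close> and \<open>C\<close>.\<close>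
  proof (rule globally_asymptotically_stable_of_lyapunov[where V = V and b = "c / E" and c = D
        and \<rho> = "max 0 (1 - c / C)"])
    show "0 < c / E" "0 < D" "0 \<le> max 0 (1 - c / C)" "max 0 (1 - c / C) < 1"
      using c C D E by auto
    fix \<xi> :: "real vec" assume \<xi>: "\<xi> \<in> carrier_vec n"
    let ?w = "R *\<^sub>v \<xi>"
    note w = Rc[OF \<xi>]
    show \<eta>': "(F * R) *\<^sub>v \<xi> \<in> carrier_vec n" using F R \<xi> by simp
    show "V \<xi> \<le> D * (\<xi> \<bullet> \<xi>)" using D \<xi> by (simp add: V_def)
    have "\<xi> \<bullet> \<xi> = ?w \<bullet> ((P * P) *\<^sub>v ?w)"
      using symmetric_mats_scalar_prod[OF P w \<xi>] assoc_mult_mat_vec[OF Pc Pc w] PR[OF \<xi>] by simp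
    then have "\<xi> \<bullet> \<xi> \<le> E * (?w \<bullet> ?w)" using E w by simp
    then have "c * (\<xi> \<bullet> \<xi>) \<le> E * (c * (?w \<bullet> ?w))"
      using c by (metis less_imp_le mult.left_commute mult_left_mono)
    also have "\<dots> \<le> E * V \<xi>"
      using lowP[OF w] V_eq[OF \<xi>] E by (intro mult_left_mono) auto
    finally show "c / E * (\<xi> \<bullet> \<xi>) \<le> V \<xi>" using E by (simp add: field_simps)
    define \<eta> where "\<eta> = (F * R) *\<^sub>v \<xi>"
    define q where "q = R *\<^sub>v \<eta>"
    have \<eta>_eq: "F *\<^sub>v ?w = \<eta>" using F R \<xi> by (simp add: \<eta>_def)
    have \<eta>: "\<eta> \<in> carrier_vec n" using \<eta>' by (simp only: \<eta>_def)
    have q: "q \<in> carrier_vec n" using Rc[OF \<eta>] by (simp add: q_def)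
    have Pq: "P *\<^sub>v q = \<eta>" using PR[OF \<eta>] by (simp add: q_def)
    have V\<eta>: "q \<bullet> \<eta> = V \<eta>" using comm_scalar_prod[OF q \<eta>] by (simp add: V_def q_def)
    \<comment> \<open>With this sign the cross term contributes \<open>- 2 * V \<eta>\<close> and
      the lower right block \<open>V \<eta>\<close>, leaving \<open>V \<xi> - V \<eta>\<close> in
      total.\<close>
    let ?z = "- q"
    have z: "?z \<in> carrier_vec n" using q by simp
    have zF: "?z \<bullet> (F *\<^sub>v ?w) = - V \<eta>"
      using \<eta> q by (simp add: \<eta>_eq V\<eta>)
    have "P *\<^sub>v ?z = - \<eta>"
      using Pc q by (intro eq_vecI) (auto simp: Pq[symmetric])
    then have zP: "?z \<bullet> (P *\<^sub>v ?z) = V \<eta>"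
      using \<eta> q by (simp add: V\<eta>)
    have "c * ((?w @\<^sub>v ?z) \<bullet> (?w @\<^sub>v ?z)) \<le> V \<xi> - V \<eta>"
      using low[of "?w @\<^sub>v ?z"] form[OF w z] zF zP V_eq[OF \<xi>] w z by simp
    \<comment> \<open>Discarding the \<open>?z\<close> part of the margin leaves a quantity
      comparable with \<open>V \<xi>\<close>, since \<open>V \<xi>\<close> is at most
      \<open>C * (?w \<bullet> ?w)\<close>.\<close>
    moreover have "c * (?w \<bullet> ?w) \<le> c * ((?w @\<^sub>v ?z) \<bullet> (?w @\<^sub>v ?z))"
      using c w z scalar_prod_self_nonneg[of ?z] by (simp add: scalar_prod_append[of _ n _ n])
    moreover have "c / C * V \<xi> \<le> c * (?w \<bullet> ?w)"
      using C V_eq[OF \<xi>] w c by (simp add: field_simps)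
    moreover have "0 \<le> V \<xi>"
      using lowP[OF w] V_eq[OF \<xi>] c scalar_prod_self_nonneg[of ?w]
      by (smt (verit) mult_nonneg_nonneg)
    then have "(1 - c / C) * V \<xi> \<le> max 0 (1 - c / C) * V \<xi>"
      by (intro mult_right_mono) auto
    ultimately show "V ((F * R) *\<^sub>v \<xi>) \<le> max 0 (1 - c / C) * V \<xi>"
      unfolding \<eta>_def[symmetric] by (simp add: left_diff_distrib)
  qed
  with R show ?thesis by (rule that)
qed

text \<open>Maps that agree on \<open>carrier_vec n\<close> may differ elsewhere, so they cannot be
  rewritten into each other as functions; closure keeps whole orbits inside the region of
  agreement.\<close>

lemma globally_asymptotically_stable_cong:
  assumes g: "globally_asymptotically_stable n g"
    and eq: "\<And>\<xi>. \<xi> \<in> carrier_vec n \<Longrightarrow> f \<xi> = g \<xi>"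
    and closed: "\<And>\<xi>. \<xi> \<in> carrier_vec n \<Longrightarrow> g \<xi> \<in> carrier_vec n"
  shows "globally_asymptotically_stable n f"
proof -
  have "(f ^^ t) \<xi> = (g ^^ t) \<xi> \<and> (g ^^ t) \<xi> \<in> carrier_vec n" if "\<xi> \<in> carrier_vec n" for \<xi> t
    using that by (induction t) (auto simp: eq closed)
  then show ?thesis
    using g eq[of "0\<^sub>v n"] unfolding globally_asymptotically_stable_def by simp
qed

section \<open>The closed loop expressed through data\<close>

theorem theorem3:
  fixes n m S T :: nat
    and A B U0 X1 Z0 P1 Y1 G2 K :: "real mat"
    and Q Z :: "real vec \<Rightarrow> real vec"
    and x u :: "nat \<Rightarrow> real vec"
    and N :: "real mat \<Rightarrow> real"
  assumes "0 < n" "0 < m" "0 < S" "0 < T" "n \<le> S"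
    and "A \<in> carrier_mat n S" "B \<in> carrier_mat n m"
    and "Q \<in> carrier_vec n \<rightarrow> carrier_vec (S - n)"
    and "Z = (\<lambda>\<xi>. \<xi> @\<^sub>v Q \<xi>)"
    and "\<forall>k\<le>T. x k \<in> carrier_vec n" "\<forall>k<T. u k \<in> carrier_vec m"
    and "\<forall>k<T. x (k + 1) = A *\<^sub>v Z (x k) + B *\<^sub>v u k"
    and "U0 = mat_of_cols m (map u [0..<T])"
    and "X1 = mat_of_cols n (map (\<lambda>k. x (k + 1)) [0..<T])"
    and "Z0 = mat_of_cols S (map (\<lambda>k. Z (x k)) [0..<T])"
    and "matrix_norm n (S - n) N"
    and "optimal_solution N n S T X1 Z0 P1 Y1 G2"
    and "N (X1 * G2) = 0"
    and "K = U0 * (Y1 @\<^sub>c G2) *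
           the (mat_inverse (four_block_mat P1 (0\<^sub>m n (S - n)) (0\<^sub>m (S - n) n) (1\<^sub>m (S - n))))"
  shows "(\<exists>M \<in> carrier_mat n n. \<forall>\<xi> \<in> carrier_vec n.
            A *\<^sub>v Z \<xi> + B *\<^sub>v (K *\<^sub>v Z \<xi>) = M *\<^sub>v \<xi>) \<and>
         globally_asymptotically_stable n (\<lambda>\<xi>. A *\<^sub>v Z \<xi> + B *\<^sub>v (K *\<^sub>v Z \<xi>))"
proof -
  note A = \<open>A \<in> carrier_mat n S\<close> and B = \<open>B \<in> carrier_mat n m\<close>
  have S: "n + (S - n) = S" using \<open>n \<le> S\<close> by simp
  have Q: "Q \<xi> \<in> carrier_vec (S - n)" if "\<xi> \<in> carrier_vec n" for \<xi>
    using that assms(8) by blast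
  have Z: "Z \<xi> \<in> carrier_vec S" if "\<xi> \<in> carrier_vec n" for \<xi>
    using append_carrier_vec[OF that Q[OF that]] S assms(9) by simp
  have U0: "U0 \<in> carrier_mat m T" and X1: "X1 \<in> carrier_mat n T" and Z0: "Z0 \<in> carrier_mat S T"
    unfolding assms(13-15) by (rule carrier_matI; simp)+
  have "feasible n S T X1 Z0 P1 Y1 G2"
    using assms(17) by (simp add: optimal_solution_def)
  then have P1: "P1 \<in> symmetric_mats n" and Y1: "Y1 \<in> carrier_mat T n"
    and G2: "G2 \<in> carrier_mat T (S - n)"
    and ZY: "Z0 * Y1 = P1 @\<^sub>r 0\<^sub>m (S - n) n"
    and pd: "positive_definite (n + n) (four_block_mat P1 ((X1 * Y1)\<^sup>T) (X1 * Y1) P1)"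
    and ZG: "Z0 * G2 = 0\<^sub>m n (S - n) @\<^sub>r 1\<^sub>m (S - n)"
    by (auto simp: feasible_def)
  have P1c: "P1 \<in> carrier_mat n n" using P1 by (simp add: symmetric_mats_def)
  have F: "X1 * Y1 \<in> carrier_mat n n" using X1 Y1 by simp
  obtain R where R: "R \<in> carrier_mat n n" "P1 * R = 1\<^sub>m n" "R * P1 = 1\<^sub>m n"
    and stable: "globally_asymptotically_stable n (\<lambda>\<xi>. (X1 * Y1 * R) *\<^sub>v \<xi>)"
    using lmi_stable[OF P1 F pd] by blast
  define M where "M = X1 * Y1 * R"
  define W where "W = Y1 @\<^sub>c G2"
  define D where "D = four_block_mat P1 (0\<^sub>m n (S - n)) (0\<^sub>m (S - n) n) (1\<^sub>m (S - n))"
  have M: "M \<in> carrier_mat n n" using F R by (simp add: M_def)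
  have W: "W \<in> carrier_mat T S" using append_cols_carrier[OF Y1 G2] S by (simp add: W_def)
  have D: "D \<in> carrier_mat S S" using P1c S unfolding D_def by (metis four_block_carrier_mat one_carrier_mat)
  \<comment> \<open>\<open>D\<close> is block diagonal with blocks \<open>P1\<close> and the
    identity, so its determinant is nonzero as soon as that of \<open>P1\<close> is.\<close>
  have "det P1 * det R = 1" using det_mult[OF P1c R(1)] R by simp
  then have "det D \<noteq> 0"
    using det_four_block_mat_upper_right_zero[OF P1c refl zero_carrier_mat one_carrier_mat]
    by (auto simp: D_def)
  then obtain E where E: "mat_inverse D = Some E" "E \<in> carrier_mat S S" "D * E = 1\<^sub>m S"
    using mat_inverse_det_nonzero[OF D] by metis
  have K: "K = U0 * W * E" using assms(19) E by (simp add: W_def D_def)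
  have Z0W: "Z0 * W = D"
    using mult_append_cols[OF Z0 Y1 G2] P1c
    by (simp add: W_def D_def ZY ZG append_cols_append_rows[of _ n n _ "S - n" _ "S - n"])
  have X1_eq: "X1 = A * Z0 + B * U0"
    unfolding assms(13-15) using assms Z
    by (intro data_matrix_identity[OF A B]) auto
  \<comment> \<open>Definiteness of the norm turns the zero cost into a matrix equation.\<close>
  have "X1 * G2 = 0\<^sub>m n (S - n)"
    using \<open>matrix_norm n (S - n) N\<close> \<open>N (X1 * G2) = 0\<close> X1 G2 by (simp add: matrix_norm_def)
  moreover have "M * P1 = X1 * Y1"
    using assoc_mult_mat[OF F R(1) P1c] right_mult_one_mat[OF F] by (simp add: M_def R(3) del: assoc_mult_mat)
  ultimately have X1W: "X1 * W = (M @\<^sub>c 0\<^sub>m n (S - n)) * D"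
    using append_cols_zero_mult_block_diag[OF M P1c] mult_append_cols[OF X1 Y1 G2]
    by (simp add: W_def D_def)
  have M0: "M @\<^sub>c 0\<^sub>m n (S - n) \<in> carrier_mat n S"
    using append_cols_carrier[OF M zero_carrier_mat, of "S - n"] S by simp
  have closed_loop: "A *\<^sub>v Z \<xi> + B *\<^sub>v (K *\<^sub>v Z \<xi>) = M *\<^sub>v \<xi>" if \<xi>: "\<xi> \<in> carrier_vec n" for \<xi>
  proof -
    \<comment> \<open>The single vector \<open>W *\<^sub>v ?y\<close> reproduces
      \<open>Z \<xi>\<close> through \<open>Z0\<close> and the input through \<open>U0\<close>, so
      the closed loop is the data equation for \<open>X1\<close> applied to it.\<close>
    let ?y = "E *\<^sub>v Z \<xi>"
    have y: "?y \<in> carrier_vec S" using E Z[OF \<xi>] by simp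
    have Wy: "W *\<^sub>v ?y \<in> carrier_vec T" using W y by simp
    have Dy: "D *\<^sub>v ?y = Z \<xi>"
      using assoc_mult_mat_vec[OF D E(2) Z[OF \<xi>]] E Z[OF \<xi>] by simp
    have "K *\<^sub>v Z \<xi> = U0 *\<^sub>v (W *\<^sub>v ?y)"
      using U0 W E(2) Z[OF \<xi>] y
      by (simp add: K assoc_mult_mat_vec[of "U0 * W" m S E S] assoc_mult_mat_vec[of U0 m T W S]
          del: assoc_mult_mat assoc_mult_mat_vec)
    moreover have "Z \<xi> = Z0 *\<^sub>v (W *\<^sub>v ?y)"
      using assoc_mult_mat_vec[OF Z0 W y] Dy Z0W by simp
    ultimately have "A *\<^sub>v Z \<xi> + B *\<^sub>v (K *\<^sub>v Z \<xi>) = A *\<^sub>v (Z0 *\<^sub>v (W *\<^sub>v ?y)) + B *\<^sub>v (U0 *\<^sub>v (W *\<^sub>v ?y))"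
      by simp
    also have "\<dots> = X1 *\<^sub>v (W *\<^sub>v ?y)"
      unfolding X1_eq using add_mult_distrib_mat_vec[of "A * Z0" n T "B * U0" "W *\<^sub>v ?y"]
        assoc_mult_mat_vec[OF A Z0 Wy] assoc_mult_mat_vec[OF B U0 Wy] A B Z0 U0 Wy by simp
    also have "\<dots> = (X1 * W) *\<^sub>v ?y" using assoc_mult_mat_vec[OF X1 W y] by simp
    also have "\<dots> = (M @\<^sub>c 0\<^sub>m n (S - n)) *\<^sub>v Z \<xi>"
      using assoc_mult_mat_vec[OF M0 D y] by (simp add: X1W Dy)
    also have "\<dots> = M *\<^sub>v \<xi>"
      using append_cols_zero_mult_vec[OF M \<xi> Q[OF \<xi>]] assms(9) by simp
    finally show ?thesis .
  qed
  moreover have "globally_asymptotically_stable n (\<lambda>\<xi>. A *\<^sub>v Z \<xi> + B *\<^sub>v (K *\<^sub>v Z \<xi>))"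
    by (rule globally_asymptotically_stable_cong[OF stable[folded M_def] closed_loop]) (use M in simp_all)
  ultimately show ?thesis using M by blast
qed

end
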